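(* Let $n \neq 1$ be a non-zero integer and let $G = BS(1,n) = \langle\, a, t \mid t^{-1} a t = a^n \,\rangle$. Then: 1) $\gamma_i G$, $i > 1$, consists of the elements $$t^{l} a^{\alpha (n-1)^{i-1}} t^{-l}, \quad l \in \mathbb{N}\cup\{0\},\ \alpha \in \mathbb{Z};$$ 2) $\gamma_i G$, $i > 1$, is isomorphic to the additive group $(n-1)^{i-2}\,\mathbb{Z}[1/n]$; in particular, $G$ is a metabelian group; 3) $G = G' \leftthreetimes \mathbb{Z}$, where $\mathbb{Z}$ is generated by the element $t$; the quotient $\gamma_i G / \gamma_{i+1} G$ is isomorphic to $\mathbb{Z}_{n-1}$ for all $i > 1$.
   Context: For a group $G$, the lower central series is defined by $\gamma_1 G = G$ and $\gamma_{i+1} G = [\gamma_i G, G]$ for $i \geq 1$, where $[A,B]$ denotes the subgroup generated by all commutators $[x,y] = x^{-1}y^{-1}xy$ with $x \in A$, $y \in B$. $G' = \gamma_2 G = [G,G]$ is the commutator subgroup of $G$. The notation $G' \leftthreetimes \mathbb{Z}$ denotes a semidirect product with normal factor $G'$ and with complement the infinite cyclic group $\mathbb{Z}$. $\mathbb{Z}_k$ denotes the cyclic group $\mathbb{Z}/k\mathbb{Z}$ (for negative $k$ it is $\mathbb{Z}/|k|\mathbb{Z}$, and $\mathbb{Z}_1$ is trivial). $\mathbb{Z}[1/n]$ is the subring of $\mathbb{Q}$ generated by $1/n$, and $(n-1)^{i-2}\mathbb{Z}[1/n]$ is the additive subgroup of multiples of $(n-1)^{i-2}$ in it.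
   Formalization: In 3), G = G' ⋊ ℤ is false internally unless n = 2 (G' and t do not generate G); proved instead: G' is normal, meets the infinite cyclic ⟨t⟩ trivially, and G is isomorphic to the semidirect product of G' and ⟨t⟩ (conjugation action) by a map that is the identity on ⟨t⟩. *)

theory Defs
  imports "HOL-Algebra.Algebra" "HOL-Algebra.Algebraic_Closure_Type"
begin

section \<open>Groups given by generators and relations\<close>

text \<open>
  The letters \<open>(x, True)\<close> and \<open>(x, False)\<close> stand for the generator \<open>x\<close> and its formal inverse.
  A relation \<open>u = v\<close> is given as the pair \<open>(u, v)\<close>. The group generated by the whole type \<open>'g\<close>
  subject to the relations \<open>R\<close> consists of the words modulo the least congruence that
  contains \<open>R\<close> and the free cancellations.
\<close>

type_synonym 'g word = "('g \<times> bool) list"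

inductive_set word_cong :: "('g word \<times> 'g word) set \<Rightarrow> ('g word \<times> 'g word) set"
  for R :: "('g word \<times> 'g word) set"
  where
    refl: "(u, u) \<in> word_cong R"
  | sym: "(u, v) \<in> word_cong R \<Longrightarrow> (v, u) \<in> word_cong R"
  | trans: "(u, v) \<in> word_cong R \<Longrightarrow> (v, w) \<in> word_cong R \<Longrightarrow> (u, w) \<in> word_cong R"
  | cancel: "(u @ [(x, b), (x, \<not> b)] @ v, u @ v) \<in> word_cong R"
  | rel: "(r, s) \<in> R \<Longrightarrow> (u @ r @ v, u @ s @ v) \<in> word_cong R"

definition presented_group :: "('g word \<times> 'g word) set \<Rightarrow> 'g word set monoid"
  where "presented_group R =
    \<lparr>carrier = UNIV // word_cong R,
     monoid.mult = (\<lambda>A B. \<Union>u\<in>A. \<Union>v\<in>B. word_cong R `` {u @ v}),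
     one = word_cong R `` {[]}\<rparr>"

definition gen_elem :: "('g word \<times> 'g word) set \<Rightarrow> 'g \<Rightarrow> 'g word set"
  where "gen_elem R x = word_cong R `` {[(x, True)]}"

definition gen_power :: "'g \<Rightarrow> int \<Rightarrow> 'g word"
  where "gen_power x k = replicate (nat \<bar>k\<bar>) (x, k \<ge> 0)"

lemma equiv_word_cong: "equiv UNIV (word_cong R)"
  by (rule equivI)
    (auto simp: refl_on_def sym_def trans_def intro: word_cong.intros)

lemma word_cong_context:
  assumes "(u, v) \<in> word_cong R"
  shows "(p @ u @ q, p @ v @ q) \<in> word_cong R"
  using assms
proof induction
  case (cancel u x b v)
  show ?case using word_cong.cancel[of "p @ u" x b "v @ q" R] by simp
next
  case (rel r s u v)
  then show ?case using word_cong.rel[of r s R "p @ u" "v @ q"] by simp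
qed (auto intro: word_cong.intros)

lemma word_cong_append:
  assumes "(u, u') \<in> word_cong R" "(v, v') \<in> word_cong R"
  shows "(u @ v, u' @ v') \<in> word_cong R"
  using word_cong_context[OF assms(1), of "[]" v] word_cong_context[OF assms(2), of u' "[]"]
  by (auto intro: word_cong.trans)

lemma presented_group_mult:
  "word_cong R `` {u} \<otimes>\<^bsub>presented_group R\<^esub> word_cong R `` {v} = word_cong R `` {u @ v}"
  using word_cong_append[of u _ R v]
  by (auto simp: presented_group_def intro: word_cong.intros)

lemma word_cong_inverse:
  "(rev (map (\<lambda>(x, b). (x, \<not> b)) u) @ u, []) \<in> word_cong R"
proof (induction u)
  case Nil
  show ?case by (simp add: word_cong.refl)
next
  case (Cons c u)
  obtain x b where c: "c = (x, b)" by (cases c)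
  have "(rev (map (\<lambda>(x, b). (x, \<not> b)) u) @ [(x, \<not> b), (x, \<not> \<not> b)] @ u,
      rev (map (\<lambda>(x, b). (x, \<not> b)) u) @ u) \<in> word_cong R"
    by (rule word_cong.cancel)
  with Cons.IH show ?case by (auto simp: c intro: word_cong.trans)
qed

lemma group_presented_group: "group (presented_group R)"
proof (rule groupI)
  have carr: "\<exists>u. A = word_cong R `` {u}" if "A \<in> carrier (presented_group R)" for A
    using that by (auto simp: presented_group_def quotient_def)
  have cls: "word_cong R `` {u} \<in> carrier (presented_group R)" for u
    by (auto simp: presented_group_def quotient_def)
  have one: "\<one>\<^bsub>presented_group R\<^esub> = word_cong R `` {[]}"
    by (simp add: presented_group_def)
  show "\<one>\<^bsub>presented_group R\<^esub> \<in> carrier (presented_group R)"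
    unfolding one by (rule cls)
  fix A assume "A \<in> carrier (presented_group R)"
  then obtain u where A: "A = word_cong R `` {u}" using carr by blast
  show "\<one>\<^bsub>presented_group R\<^esub> \<otimes>\<^bsub>presented_group R\<^esub> A = A"
    unfolding one A presented_group_mult by simp
  have "word_cong R `` {rev (map (\<lambda>(x, b). (x, \<not> b)) u)} \<otimes>\<^bsub>presented_group R\<^esub> A
      = \<one>\<^bsub>presented_group R\<^esub>"
    unfolding one A presented_group_mult
    by (rule equiv_class_eq[OF equiv_word_cong word_cong_inverse])
  then show "\<exists>B\<in>carrier (presented_group R). B \<otimes>\<^bsub>presented_group R\<^esub> A = \<one>\<^bsub>presented_group R\<^esub>"
    using cls by blast
  fix B assume "B \<in> carrier (presented_group R)"
  then obtain v where B: "B = word_cong R `` {v}" using carr by blast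
  show "A \<otimes>\<^bsub>presented_group R\<^esub> B \<in> carrier (presented_group R)"
    unfolding A B presented_group_mult by (rule cls)
  fix C assume "C \<in> carrier (presented_group R)"
  then obtain w where C: "C = word_cong R `` {w}" using carr by blast
  show "A \<otimes>\<^bsub>presented_group R\<^esub> B \<otimes>\<^bsub>presented_group R\<^esub> C
      = A \<otimes>\<^bsub>presented_group R\<^esub> (B \<otimes>\<^bsub>presented_group R\<^esub> C)"
    unfolding A B C presented_group_mult by simp
qed

section \<open>The groups \<open>BS(1,n)\<close>\<close>

datatype bs_gen = Gen_a | Gen_t

definition BS1_rels :: "int \<Rightarrow> (bs_gen word \<times> bs_gen word) set"
  where "BS1_rels n = {([(Gen_t, False), (Gen_a, True), (Gen_t, True)], gen_power Gen_a n)}"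

definition BS1 :: "int \<Rightarrow> bs_gen word set monoid"
  where "BS1 n = presented_group (BS1_rels n)"

definition BS1_a :: "int \<Rightarrow> bs_gen word set"
  where "BS1_a n = gen_elem (BS1_rels n) Gen_a"

definition BS1_t :: "int \<Rightarrow> bs_gen word set"
  where "BS1_t n = gen_elem (BS1_rels n) Gen_t"

section \<open>Lower central series, metabelian groups\<close>

definition commutator_subgroup :: "('a, 'b) monoid_scheme \<Rightarrow> 'a set \<Rightarrow> 'a set \<Rightarrow> 'a set"
  where "commutator_subgroup G A B =
    generate G (\<Union>x\<in>A. \<Union>y\<in>B. {inv\<^bsub>G\<^esub> x \<otimes>\<^bsub>G\<^esub> inv\<^bsub>G\<^esub> y \<otimes>\<^bsub>G\<^esub> x \<otimes>\<^bsub>G\<^esub> y})"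

text \<open>The series is indexed from 1; the value at 0 is a dummy.\<close>

fun lower_central :: "('a, 'b) monoid_scheme \<Rightarrow> nat \<Rightarrow> 'a set"
  where
    "lower_central G 0 = carrier G"
  | "lower_central G (Suc 0) = carrier G"
  | "lower_central G (Suc (Suc i)) =
       commutator_subgroup G (lower_central G (Suc i)) (carrier G)"

definition metabelian :: "('a, 'b) monoid_scheme \<Rightarrow> bool"
  where "metabelian G \<longleftrightarrow> group G \<and>
    comm_group (G\<lparr>carrier := commutator_subgroup G (carrier G) (carrier G)\<rparr>)"

section \<open>Semidirect products\<close>

definition semidirect_product ::
    "('a, 'c) monoid_scheme \<Rightarrow> ('b, 'd) monoid_scheme \<Rightarrow> ('b \<Rightarrow> 'a \<Rightarrow> 'a) \<Rightarrow> ('a \<times> 'b) monoid"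
  where "semidirect_product N H \<phi> =
    \<lparr>carrier = carrier N \<times> carrier H,
     monoid.mult = (\<lambda>(x, h) (y, k). (x \<otimes>\<^bsub>N\<^esub> \<phi> h y, h \<otimes>\<^bsub>H\<^esub> k)),
     one = (\<one>\<^bsub>N\<^esub>, \<one>\<^bsub>H\<^esub>)\<rparr>"

text \<open>
  The semidirect product of a normal subgroup \<open>N\<close> and a subgroup \<open>H\<close> of \<open>G\<close>, with \<open>H\<close> acting on \<open>N\<close>
  by conjugation in \<open>G\<close>; \<open>N\<close> and \<open>H\<close> need not generate \<open>G\<close>.
\<close>

definition conj_semidirect :: "('a, 'b) monoid_scheme \<Rightarrow> 'a set \<Rightarrow> 'a set \<Rightarrow> ('a \<times> 'a) monoid"
  where "conj_semidirect G N H =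
    semidirect_product (G\<lparr>carrier := N\<rparr>) (G\<lparr>carrier := H\<rparr>) (\<lambda>h x. h \<otimes>\<^bsub>G\<^esub> x \<otimes>\<^bsub>G\<^esub> inv\<^bsub>G\<^esub> h)"

section \<open>Additive groups of rational numbers\<close>

definition Z_inverse :: "int \<Rightarrow> rat set"
  where "Z_inverse n = generate_ring (ring_of_type_algebra :: rat ring) {1 / of_int n}"

definition rat_additive :: "rat set \<Rightarrow> rat monoid"
  where "rat_additive S = \<lparr>carrier = S, monoid.mult = (+), one = 0\<rparr>"

end

theory Submission
  imports Defs
begin

text \<open>
  Sending \<open>a\<close> to \<open>y \<mapsto> y + 1\<close> and \<open>t\<close> to \<open>y \<mapsto> y / n\<close> represents \<open>BS(1,n)\<close> by affine maps of \<open>\<rat>\<close>.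
  Since every element has the form \<open>t\<^sup>l a\<^sup>k t\<^sup>m\<close> with \<open>l \<ge> 0\<close>, the representation is faithful, and its
  image consists of all maps \<open>y \<mapsto> n\<^sup>-\<^sup>k y + x\<close> with \<open>x \<in> \<int>[1/n]\<close>. The commutator of the translation
  by \<open>x\<close> with an element of height \<open>k\<close> is the translation by \<open>(n\<^sup>k - 1) x\<close>, a multiple of
  \<open>n - 1\<close>, so \<open>\<gamma>\<^sub>i\<close> corresponds to the translations in \<open>(n - 1)\<^sup>i\<^sup>-\<^sup>1 \<int>[1/n]\<close>. As
  \<open>n \<equiv> 1\<close> modulo \<open>n - 1\<close>, the numerator of an element of \<open>\<int>[1/n]\<close> is well defined modulo
  \<open>n - 1\<close>, which gives the quotients.
\<close>

section \<open>The ring \<open>\<int>[1/n]\<close>\<close>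

lemma Z_inverse_one: "1 \<in> Z_inverse n"
  using generate_ring.one[of "ring_of_type_algebra :: rat ring"]
  by (simp add: Z_inverse_def ring_of_type_algebra_def)

lemma Z_inverse_add: "x \<in> Z_inverse n \<Longrightarrow> y \<in> Z_inverse n \<Longrightarrow> x + y \<in> Z_inverse n"
  using generate_ring.eng_add[of x "ring_of_type_algebra :: rat ring"]
  by (simp add: Z_inverse_def ring_of_type_algebra_def)

lemma Z_inverse_mult: "x \<in> Z_inverse n \<Longrightarrow> y \<in> Z_inverse n \<Longrightarrow> x * y \<in> Z_inverse n"
  using generate_ring.eng_mult[of x "ring_of_type_algebra :: rat ring"]
  by (simp add: Z_inverse_def ring_of_type_algebra_def)

lemma a_inv_ring_of_type_algebra:
  "\<ominus>\<^bsub>ring_of_type_algebra\<^esub> x = - (x :: 'a :: comm_ring_1)"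
proof -
  interpret R: ring "ring_of_type_algebra :: 'a ring" by (rule ring_from_type_algebra)
  show ?thesis
    by (rule R.minus_equality) (auto simp: ring_of_type_algebra_def)
qed

lemma Z_inverse_minus: "x \<in> Z_inverse n \<Longrightarrow> - x \<in> Z_inverse n"
  using generate_ring.a_inv[of x "ring_of_type_algebra :: rat ring"]
  by (simp add: Z_inverse_def a_inv_ring_of_type_algebra)

lemma Z_inverse_of_int: "of_int k \<in> Z_inverse n"
proof (induction k rule: int_induct[where k = 0])
  case base
  then show ?case using Z_inverse_add[OF Z_inverse_one Z_inverse_minus[OF Z_inverse_one]] by simp
next
  case (step1 i)
  then show ?case using Z_inverse_add[OF _ Z_inverse_one] by simp
next
  case (step2 i)
  then show ?case using Z_inverse_add[OF _ Z_inverse_minus[OF Z_inverse_one]] by fastforce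
qed

lemma Z_inverse_frac: "of_int k / of_int n ^ l \<in> Z_inverse n"
proof (induction l)
  case 0
  show ?case by (simp add: Z_inverse_of_int)
next
  case (Suc l)
  have "1 / of_int n \<in> Z_inverse n"
    unfolding Z_inverse_def by (rule generate_ring.incl) simp
  from Z_inverse_mult[OF Suc this] show ?case by (simp add: mult.commute)
qed

lemma frac_add:
  assumes "n \<noteq> 0"
  shows "of_int j / of_int n ^ k + of_int l / of_int n ^ m
    = (of_int (j * n ^ m + l * n ^ k) / of_int n ^ (k + m) :: rat)"
  using assms by (simp add: add_frac_eq power_add)

text \<open>Fractions whose denominator is a power of \<open>n\<close> contain \<open>1 / n\<close>
  and are closed under the ring operations. The fraction need not be reduced, so \<open>k\<close>
  and \<open>l\<close> are not unique.\<close>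

lemma Z_inverse_cases:
  assumes "x \<in> Z_inverse n" and "n \<noteq> 0"
  obtains k l where "x = of_int k / of_int n ^ l"
proof -
  have "\<exists>k l. x = of_int k / of_int n ^ l"
    using assms(1) unfolding Z_inverse_def
  proof induction
    case one
    have "(1::rat) = of_int 1 / of_int n ^ 0" by simp
    then show ?case unfolding ring_of_type_algebra_def by (simp only: monoid.simps) blast
  next
    case (incl h)
    then have "h = of_int 1 / of_int n ^ 1" by simp
    then show ?case by blast
  next
    case (a_inv h)
    then obtain k l where "h = of_int k / of_int n ^ l" by blast
    then have "- h = of_int (- k) / of_int n ^ l" by simp
    then show ?case unfolding a_inv_ring_of_type_algebra by blast
  next
    case (eng_add h1 h2)
    then obtain j k l m where "h1 = of_int j / of_int n ^ k" "h2 = of_int l / of_int n ^ m" by blast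
    then have "h1 + h2 = of_int (j * n ^ m + l * n ^ k) / of_int n ^ (k + m)"
      by (simp only: frac_add[OF \<open>n \<noteq> 0\<close>])
    then show ?case by (auto simp only: ring_of_type_algebra_def ring.simps)
  next
    case (eng_mult h1 h2)
    then obtain j k l m where "h1 = of_int j / of_int n ^ k" "h2 = of_int l / of_int n ^ m" by blast
    then have "h1 * h2 = of_int (j * l) / of_int n ^ (k + m)"
      by (simp add: power_add)
    then show ?case by (auto simp only: ring_of_type_algebra_def monoid.simps)
  qed
  then show ?thesis using that by blast
qed

lemma Z_inverse_powi: "of_int n powi k \<in> Z_inverse n"
proof (cases k rule: int_cases2)
  case (nonneg m)
  then show ?thesis using Z_inverse_of_int[of "n ^ m" n] by simp
next
  case (nonpos m)
  then show ?thesis using Z_inverse_frac[of 1 n m] by (simp add: power_int_minus_divide)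
qed

text \<open>For \<open>k \<ge> 0\<close> the cofactor is the geometric sum, an integer. For negative
  exponents the unit \<open>1 / n ^ m\<close> is split off first. This supplies the factor
  \<open>n - 1\<close> in every commutator.\<close>

lemma powi_minus_1_dvd:
  assumes "n \<noteq> 0"
  obtains y where "y \<in> Z_inverse n" "of_int n powi k - 1 = of_int (n - 1) * y"
proof -
  have nonneg: "\<exists>q::int. (of_int n ^ m - 1 :: rat) = of_int (n - 1) * of_int q" for m
    using power_diff_1_eq[of "of_int n :: rat" m] by (intro exI[of _ "\<Sum>i<m. n ^ i"]) simp
  have "\<exists>y\<in>Z_inverse n. of_int n powi k - 1 = of_int (n - 1) * y"
  proof (cases k rule: int_cases2)
    case k: (nonneg m)
    obtain q :: int where "(of_int n ^ m - 1 :: rat) = of_int (n - 1) * of_int q"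
      using nonneg by blast
    then show ?thesis using k Z_inverse_of_int by auto
  next
    case k: (nonpos m)
    obtain q :: int where q: "(of_int n ^ m - 1 :: rat) = of_int (n - 1) * of_int q"
      using nonneg by blast
    have "of_int n powi k - 1 = - (of_int n ^ m - 1 :: rat) / of_int n ^ m"
      using assms by (simp add: k power_int_minus_divide diff_divide_distrib)
    also have "\<dots> = of_int (n - 1) * (of_int (- q) / of_int n ^ m)"
      unfolding q by simp
    finally show ?thesis using Z_inverse_frac by blast
  qed
  then show ?thesis using that by blast
qed

section \<open>Residues of Z[1/n] modulo n - 1\<close>

lemma dvd_mult_power_diff: "(n - 1) dvd j * n ^ m - (j::int)"
proof -
  have "n ^ m - 1 = (n - 1) * (\<Sum>i<m. n ^ i)" by (rule power_diff_1_eq)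
  then have "(n - 1) dvd j * (n ^ m - 1)" by simp
  then show ?thesis by (simp add: right_diff_distrib)
qed

text \<open>Cross-multiplication gives \<open>k * n ^ l' = k' * n ^ l\<close>, and powers of
  \<open>n\<close> are 1 modulo \<open>n - 1\<close>. Hence all numerators of one number agree
  modulo \<open>n - 1\<close>.\<close>

lemma frac_eq_dvd:
  assumes "n \<noteq> 0" and "of_int k / of_int n ^ l = (of_int k' / of_int n ^ l' :: rat)"
  shows "(n - 1) dvd k - k'"
proof -
  have "of_int (k * n ^ l') = (of_int (k' * n ^ l) :: rat)"
    using assms by (simp add: frac_eq_eq)
  then have eq: "k * n ^ l' = k' * n ^ l" by (simp only: of_int_eq_iff)
  have "k - k' = (k' * n ^ l - k') - (k * n ^ l' - k)" using eq by simp
  then show ?thesis using dvd_mult_power_diff by (simp only: dvd_diff)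
qed

text \<open>On Z[1/n] this is the ring homomorphism onto the integers modulo \<open>n - 1\<close>,
  under which \<open>n\<close> becomes 1. The absolute value yields the nonnegative representatives
  used by \<open>integer_mod_group\<close>, also for negative \<open>n\<close>.\<close>

definition residue :: "int \<Rightarrow> rat \<Rightarrow> int"
  where "residue n x = (SOME k. \<exists>l. x = of_int k / of_int n ^ l) mod \<bar>n - 1\<bar>"

lemma residue_frac:
  assumes "n \<noteq> 0"
  shows "residue n (of_int k / of_int n ^ l) = k mod \<bar>n - 1\<bar>"
proof -
  define k' where "k' = (SOME k'. \<exists>l'. of_int k / of_int n ^ l = (of_int k' / of_int n ^ l' :: rat))"
  have "\<exists>l'. of_int k / of_int n ^ l = (of_int k' / of_int n ^ l' :: rat)"
    unfolding k'_def by (rule someI_ex) blast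
  then have "(n - 1) dvd k' - k"
    using frac_eq_dvd[OF assms] by metis
  then have "k' mod \<bar>n - 1\<bar> = k mod \<bar>n - 1\<bar>"
    by (simp add: mod_eq_dvd_iff)
  then show ?thesis by (simp add: residue_def k'_def)
qed

lemma residue_add:
  assumes "n \<noteq> 0" "x \<in> Z_inverse n" "y \<in> Z_inverse n"
  shows "residue n (x + y) = (residue n x + residue n y) mod \<bar>n - 1\<bar>"
proof -
  obtain j k where x: "x = of_int j / of_int n ^ k" using Z_inverse_cases[OF assms(2,1)] .
  obtain l m where y: "y = of_int l / of_int n ^ m" using Z_inverse_cases[OF assms(3,1)] .
  have "residue n (x + y) = (j * n ^ m + l * n ^ k) mod \<bar>n - 1\<bar>"
    unfolding x y frac_add[OF assms(1)] residue_frac[OF assms(1)] ..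
  \<comment> \<open>The powers of \<open>n\<close> that come from the common denominator are 1
    modulo \<open>n - 1\<close>.\<close>
  also have "\<dots> = (j + l) mod \<bar>n - 1\<bar>"
  proof -
    have "(n - 1) dvd (j * n ^ m - j) + (l * n ^ k - l)"
      using dvd_mult_power_diff by (rule dvd_add) (rule dvd_mult_power_diff)
    then show ?thesis by (simp add: mod_eq_dvd_iff algebra_simps)
  qed
  finally show ?thesis
    unfolding x y residue_frac[OF assms(1)] by (simp add: mod_add_eq)
qed

text \<open>The kernel of the residue map is the ideal generated by \<open>n - 1\<close>: a factor
  \<open>n - 1\<close> of some numerator is a factor of the fraction, and conversely.\<close>

lemma residue_eq_0_iff:
  assumes "n \<noteq> 0" "x \<in> Z_inverse n"
  shows "residue n x = 0 \<longleftrightarrow> (\<exists>y\<in>Z_inverse n. x = of_int (n - 1) * y)"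
proof
  obtain k l where x: "x = of_int k / of_int n ^ l" using Z_inverse_cases[OF assms(2,1)] .
  assume "residue n x = 0"
  then have "(n - 1) dvd k" by (simp add: x residue_frac[OF assms(1)] mod_eq_0_iff_dvd)
  then obtain q where "k = (n - 1) * q" ..
  then have "x = of_int (n - 1) * (of_int q / of_int n ^ l)" by (simp add: x)
  then show "\<exists>y\<in>Z_inverse n. x = of_int (n - 1) * y" using Z_inverse_frac by blast
next
  assume "\<exists>y\<in>Z_inverse n. x = of_int (n - 1) * y"
  then obtain y where y: "y \<in> Z_inverse n" "x = of_int (n - 1) * y" by blast
  obtain k l where "y = of_int k / of_int n ^ l" using Z_inverse_cases[OF y(1) assms(1)] .
  then have "x = of_int ((n - 1) * k) / of_int n ^ l" using y by simp
  then show "residue n x = 0"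
    by (simp only: residue_frac[OF assms(1)]) (simp add: mod_eq_0_iff_dvd)
qed

section \<open>The affine representation\<close>

text \<open>
  The pair \<open>(x, k)\<close> stands for the affine map \<open>y \<mapsto> n\<^sup>-\<^sup>k y + x\<close>.
\<close>

fun word_val :: "int \<Rightarrow> bs_gen word \<Rightarrow> rat \<times> int"
  where
    "word_val n [] = (0, 0)"
  | "word_val n ((Gen_a, b) # w) =
      (fst (word_val n w) + (if b then 1 else - 1), snd (word_val n w))"
  | "word_val n ((Gen_t, b) # w) =
      (if b then (fst (word_val n w) / of_int n, snd (word_val n w) + 1)
       else (fst (word_val n w) * of_int n, snd (word_val n w) - 1))"

text \<open>This is the composition of affine maps with \<open>v\<close> applied first: the slope of
  \<open>u\<close>, which is \<open>n\<close> to the minus its height, scales the translation part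
  of \<open>v\<close>.\<close>

lemma word_val_append:
  assumes "n \<noteq> 0"
  shows "word_val n (u @ v) =
    (fst (word_val n u) + fst (word_val n v) * of_int n powi (- snd (word_val n u)),
     snd (word_val n u) + snd (word_val n v))"
  using assms
proof (induction n u rule: word_val.induct)
  case (3 n b w)
  then have "of_int n powi (- 1 - m) = (of_int n powi (- m) / of_int n :: rat)"
    "of_int n powi (1 - m) = (of_int n powi (- m) * of_int n :: rat)" for m
    using power_int_add[of "of_int n :: rat" "- 1" "- m"] power_int_add[of "of_int n :: rat" "- m" 1]
    by (simp_all add: field_class.field_divide_inverse)
  with 3 show ?case by (simp add: algebra_simps add_divide_distrib)
qed (simp_all add: algebra_simps)

lemma word_val_gen_power: "word_val n (gen_power Gen_a k) = (of_int k, 0)"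
proof -
  have "word_val n (replicate m (Gen_a, b)) = ((if b then of_nat m else - of_nat m), 0)" for m b
    by (induction m) auto
  then show ?thesis by (simp add: gen_power_def)
qed

text \<open>The defining relation holds for the affine maps: y goes to y/n, then to y/n + 1, then to
  y + n, which is the map of \<open>a\<close> to the power \<open>n\<close>.\<close>

lemma word_val_cong:
  assumes "(u, v) \<in> word_cong (BS1_rels n)" and "n \<noteq> 0"
  shows "word_val n u = word_val n v"
  using assms(1)
proof induction
  case (cancel u x b v)
  show ?case using \<open>n \<noteq> 0\<close> by (cases x) (auto simp: word_val_append)
next
  case (rel r s u v)
  then show ?case using \<open>n \<noteq> 0\<close>
    by (simp add: BS1_rels_def word_val_append word_val_gen_power distrib_right)
qed simp_all

lemma (in group) mult_inv_cancel [simp]: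
  assumes "x \<in> carrier G" "y \<in> carrier G"
  shows "x \<otimes> (inv x \<otimes> y) = y" and "inv x \<otimes> (x \<otimes> y) = y"
  using assms by (simp_all add: m_assoc[symmetric])

section \<open>The affine representation as a pair of functions on the group\<close>

locale baumslag_solitar_1 =
  fixes n :: int and G (structure) and a t
  assumes n_neq_0: "n \<noteq> 0" and n_neq_1: "n \<noteq> 1"
    and G_eq: "G = BS1 n" and a_eq: "a = BS1_a n" and t_eq: "t = BS1_t n"

sublocale baumslag_solitar_1 \<subseteq> group G
  using group_presented_group by (simp add: G_eq BS1_def)

context baumslag_solitar_1
begin

abbreviation cls :: "bs_gen word \<Rightarrow> bs_gen word set"
  where "cls u \<equiv> word_cong (BS1_rels n) `` {u}"

text \<open>\<open>word_val\<close> is constant on a congruence class, so its image there is a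
  singleton and \<open>the_elem\<close> reads off the value. This component is the value of the
  affine map at 0.\<close>

definition translation :: "bs_gen word set \<Rightarrow> rat"
  where "translation g = fst (the_elem (word_val n ` g))"

definition height :: "bs_gen word set \<Rightarrow> int"
  where "height g = snd (the_elem (word_val n ` g))"

lemma carrier_cases:
  assumes "g \<in> carrier G"
  obtains u where "g = cls u"
  using assms by (auto simp: G_eq BS1_def presented_group_def quotient_def)

lemma cls_closed [simp]: "cls u \<in> carrier G"
  by (auto simp: G_eq BS1_def presented_group_def quotient_def)

lemma mult_cls: "cls u \<otimes> cls v = cls (u @ v)"
  by (simp add: G_eq BS1_def presented_group_mult)

lemma one_eq: "\<one> = cls []"
  by (simp add: G_eq BS1_def presented_group_def)

lemma word_val_image_cls: "word_val n ` cls u = {word_val n u}"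
  using word_val_cong[OF _ n_neq_0] by (force intro: word_cong.refl)

lemma translation_cls: "translation (cls u) = fst (word_val n u)"
  and height_cls: "height (cls u) = snd (word_val n u)"
  by (simp_all add: translation_def height_def word_val_image_cls)

lemma a_cls: "a = cls [(Gen_a, True)]" and t_cls: "t = cls [(Gen_t, True)]"
  by (simp_all add: a_eq t_eq BS1_a_def BS1_t_def gen_elem_def)

lemma a_closed [simp]: "a \<in> carrier G" and t_closed [simp]: "t \<in> carrier G"
  by (simp_all add: a_cls t_cls)

lemma inv_gen: "inv (cls [(x, True)]) = cls [(x, False)]"
proof (rule inv_equality)
  have "([(x, False), (x, True)], []) \<in> word_cong (BS1_rels n)"
    using word_cong.cancel[of "[]" x False "[]"] by simp
  then show "cls [(x, False)] \<otimes> cls [(x, True)] = \<one>"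
    unfolding mult_cls one_eq
    by (simp add: equiv_class_eq[OF equiv_word_cong])
qed simp_all

lemma a_t: "inv t \<otimes> a \<otimes> t = a [^] n"
proof -
  have gp: "cls (replicate m (Gen_a, b)) = (if b then a [^] m else inv a [^] m)" for m :: nat and b
  proof (induction m)
    case (Suc m)
    have "cls (replicate (Suc m) (Gen_a, b)) = cls (replicate m (Gen_a, b)) \<otimes> cls [(Gen_a, b)]"
      by (simp add: mult_cls replicate_append_same)
    then show ?case using Suc by (simp add: a_cls inv_gen)
  qed (simp add: one_eq)
  have "([(Gen_t, False), (Gen_a, True), (Gen_t, True)], gen_power Gen_a n) \<in> word_cong (BS1_rels n)"
    using word_cong.rel[of _ _ "BS1_rels n" "[]" "[]"] by (simp add: BS1_rels_def)
  then have "cls [(Gen_t, False), (Gen_a, True), (Gen_t, True)] = cls (gen_power Gen_a n)"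
    by (rule equiv_class_eq[OF equiv_word_cong])
  moreover have "cls [(Gen_t, False), (Gen_a, True), (Gen_t, True)] = inv t \<otimes> a \<otimes> t"
    by (simp add: t_cls a_cls inv_gen mult_cls)
  moreover have "cls (gen_power Gen_a n) = a [^] n"
    unfolding gen_power_def gp int_pow_def2 nat_pow_inv[OF a_closed] by simp
  ultimately show ?thesis by simp
qed

lemma translation_one [simp]: "translation \<one> = 0" and height_one [simp]: "height \<one> = 0"
  unfolding one_eq translation_cls height_cls by simp_all

lemma
  assumes "g \<in> carrier G" "h \<in> carrier G"
  shows translation_mult:
      "translation (g \<otimes> h) = translation g + translation h * of_int n powi (- height g)"
    and height_mult: "height (g \<otimes> h) = height g + height h"
proof -
  obtain u where "g = cls u" by (rule carrier_cases[OF assms(1)])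
  moreover obtain v where "h = cls v" by (rule carrier_cases[OF assms(2)])
  ultimately show "translation (g \<otimes> h) = translation g + translation h * of_int n powi (- height g)"
    "height (g \<otimes> h) = height g + height h"
    by (simp_all only: mult_cls translation_cls height_cls word_val_append[OF n_neq_0] fst_conv snd_conv)
qed

lemma height_inv: "g \<in> carrier G \<Longrightarrow> height (inv g) = - height g"
  using height_mult[of "inv g" g] by simp

lemma translation_inv:
  assumes "g \<in> carrier G"
  shows "translation (inv g) = - translation g * of_int n powi height g"
proof -
  have "translation (inv g) + translation g * of_int n powi height g = 0"
    using translation_mult[of "inv g" g] assms height_inv[OF assms] by (simp only: inv_closed l_inv translation_one minus_minus)
  then show ?thesis by (simp only: eq_neg_iff_add_eq_0 mult_minus_left)
qed

lemma translation_a_pow: "translation (a [^] (k::int)) = of_int k" (is ?tr)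
  and height_a_pow: "height (a [^] k) = 0" (is ?ht)
proof -
  have a: "translation a = 1" "height a = 0"
    by (simp_all add: a_cls translation_cls height_cls)
  have "?tr \<and> ?ht"
  proof (induction k rule: int_induct[where k = 0])
    case (step1 i)
    then show ?case by (simp add: int_pow_mult translation_mult height_mult a)
  next
    case (step2 i)
    then show ?case
      by (simp add: int_pow_diff translation_mult height_mult translation_inv height_inv a)
  qed simp
  then show ?tr ?ht by auto
qed

lemma translation_t_pow: "translation (t [^] (k::int)) = 0" (is ?tr)
  and height_t_pow: "height (t [^] k) = k" (is ?ht)
proof -
  have t: "translation t = 0" "height t = 1"
    by (simp_all add: t_cls translation_cls height_cls)
  have "?tr \<and> ?ht"
  proof (induction k rule: int_induct[where k = 0])
    case (step1 i)
    then show ?case by (simp add: int_pow_mult translation_mult height_mult t)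
  next
    case (step2 i)
    then show ?case
      by (simp add: int_pow_diff translation_mult height_mult translation_inv height_inv t)
  qed simp
  then show ?tr ?ht by auto
qed

section \<open>Normal forms and faithfulness of the representation\<close>

lemma a_pow_t: "a [^] (k::int) \<otimes> t = t \<otimes> a [^] (n * k)"
proof -
  have "inv t \<otimes> a [^] k \<otimes> t = (inv t \<otimes> a \<otimes> t) [^] k"
  proof -
    \<comment> \<open>Conjugation by \<open>t\<close> is an endomorphism, so the relation for
      \<open>a\<close> carries over to all its powers.\<close>
    have "group_hom G G (\<lambda>x. inv t \<otimes> x \<otimes> t)"
      by unfold_locales (simp add: hom_def m_assoc)
    from group_hom.hom_int_pow[OF this] show ?thesis by simp
  qed
  then have "inv t \<otimes> (a [^] k \<otimes> t) = a [^] (n * k)"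
    by (simp add: a_t int_pow_pow m_assoc)
  then show ?thesis by (simp add: inv_solve_left')
qed

text \<open>Each \<open>t\<close> that moves to the left past a power of \<open>a\<close> multiplies
  the exponent by \<open>n\<close>. Only nonnegative powers of \<open>t\<close> move this way, as
  the opposite direction would divide the exponent.\<close>

lemma a_pow_t_pow: "a [^] (k::int) \<otimes> t [^] (l::nat) = t [^] l \<otimes> a [^] (k * n ^ l)"
proof (induction l)
  case (Suc l)
  have "a [^] k \<otimes> t [^] Suc l = (a [^] k \<otimes> t [^] l) \<otimes> t"
    by (simp add: m_assoc)
  also have "\<dots> = t [^] l \<otimes> (a [^] (k * n ^ l) \<otimes> t)"
    unfolding Suc by (simp add: m_assoc)
  also have "\<dots> = t [^] Suc l \<otimes> a [^] (k * n ^ Suc l)"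
    unfolding a_pow_t by (simp add: m_assoc mult.left_commute)
  finally show ?case .
qed simp

text \<open>Induction on the word, multiplying a normal form by one letter on the left. A letter for
  \<open>a\<close> passes \<open>t [^] l\<close> and merges with the middle power; \<open>t\<close>
  raises \<open>l\<close>, and its inverse lowers \<open>l\<close> as long as
  \<open>l > 0\<close>.\<close>

lemma cls_normal_form:
  "\<exists>(l::nat) (k::int) (m::int). cls u = t [^] l \<otimes> a [^] k \<otimes> t [^] m"
proof (induction u)
  case Nil
  have "cls [] = t [^] (0::nat) \<otimes> a [^] (0::int) \<otimes> t [^] (0::int)"
    by (simp add: one_eq)
  then show ?case by blast
next
  case (Cons xb u)
  then obtain l :: nat and k m :: int where u: "cls u = t [^] l \<otimes> a [^] k \<otimes> t [^] m"
    by blast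
  have eq: "cls (xb # u) = cls [xb] \<otimes> (t [^] l \<otimes> a [^] k \<otimes> t [^] m)"
    unfolding u[symmetric] mult_cls by simp
  consider b where "xb = (Gen_a, b)" | "xb = (Gen_t, True)" | "xb = (Gen_t, False)"
    by (metis bs_gen.exhaust surj_pair)
  then show ?case
  proof cases
    case 1
    define e :: int where "e = (if b then 1 else - 1)"
    have "cls [xb] = a [^] e"
      unfolding 1 e_def by (cases b) (simp_all add: int_pow_neg a_cls inv_gen)
    then have "cls (xb # u) = (a [^] e \<otimes> t [^] l) \<otimes> a [^] k \<otimes> t [^] m"
      unfolding eq by (simp add: m_assoc)
    also have "\<dots> = t [^] l \<otimes> a [^] (e * n ^ l + k) \<otimes> t [^] m"
      unfolding a_pow_t_pow by (simp add: int_pow_mult m_assoc)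
    finally show ?thesis by blast
  next
    case 2
    then have "cls (xb # u) = (t \<otimes> t [^] l) \<otimes> a [^] k \<otimes> t [^] m"
      unfolding eq by (simp add: m_assoc t_cls)
    also have "t \<otimes> t [^] l = t [^] Suc l"
      by (rule nat_pow_Suc2[OF t_closed, symmetric])
    finally show ?thesis by blast
  next
    case 3
    then have eq': "cls (xb # u) = inv t \<otimes> (t [^] l \<otimes> a [^] k \<otimes> t [^] m)"
      unfolding eq by (simp add: t_cls inv_gen)
    show ?thesis
    proof (cases l)
      \<comment> \<open>There is no \<open>t\<close> left to cancel, so \<open>inv t\<close> moves
        to the right past the power of \<open>a\<close> and is absorbed by the last factor.\<close>
      case 0
      have "inv t \<otimes> a [^] k = a [^] (n * k) \<otimes> inv t"
        using a_pow_t[of k] by (simp add: inv_solve_left' inv_solve_right m_assoc)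
      then have "cls (xb # u) = a [^] (n * k) \<otimes> inv t \<otimes> t [^] m"
        unfolding eq' 0 by (simp add: m_assoc[symmetric])
      also have "\<dots> = t [^] (0::nat) \<otimes> a [^] (n * k) \<otimes> t [^] (- 1 + m)"
        unfolding int_pow_mult[OF t_closed] by (simp add: int_pow_neg m_assoc)
      finally show ?thesis by blast
    next
      case (Suc l')
      have "cls (xb # u) = t [^] l' \<otimes> a [^] k \<otimes> t [^] m"
        unfolding eq' Suc nat_pow_Suc2[OF t_closed] by (simp add: m_assoc[symmetric])
      then show ?thesis by blast
    qed
  qed
qed

lemma translation_normal_form:
    "translation (t [^] (l::nat) \<otimes> a [^] (k::int) \<otimes> t [^] (m::int)) = of_int k / of_int n ^ l"
  and height_normal_form: "height (t [^] l \<otimes> a [^] k \<otimes> t [^] m) = int l + m"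
  using translation_t_pow[of "int l"] height_t_pow[of "int l"]
  by (simp_all add: translation_mult height_mult translation_a_pow height_a_pow int_pow_int
      translation_t_pow height_t_pow power_int_minus_divide)

lemma normal_form:
  assumes "g \<in> carrier G"
  obtains l :: nat and k m :: int where "g = t [^] l \<otimes> a [^] k \<otimes> t [^] m"
  using carrier_cases[OF assms] cls_normal_form by metis

lemma translation_in_Z_inverse: "g \<in> carrier G \<Longrightarrow> translation g \<in> Z_inverse n"
  using normal_form[of g] Z_inverse_frac translation_normal_form by metis

text \<open>Faithfulness: for a normal form, translation \<open>k / n ^ l = 0\<close> forces
  \<open>k = 0\<close>, and height \<open>l + m = 0\<close> makes the remaining powers of
  \<open>t\<close> cancel.\<close>

lemma eq_oneI:
  assumes "g \<in> carrier G" "translation g = 0" "height g = 0"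
  shows "g = \<one>"
proof -
  obtain l :: nat and k m :: int where g: "g = t [^] l \<otimes> a [^] k \<otimes> t [^] m"
    using normal_form[OF assms(1)] .
  have "of_int k / of_int n ^ l = (0::rat)" "int l + m = 0"
    using assms(2,3) unfolding g translation_normal_form height_normal_form .
  then have "k = 0" "m = - int l"
    using n_neq_0 by simp_all
  then show ?thesis by (simp add: g int_pow_neg_int)
qed

text \<open>Apply \<open>eq_oneI\<close> to the quotient of \<open>g\<close> and \<open>h\<close>.
  Equations in the group thereby become arithmetic with the two coordinates.\<close>

lemma eqI:
  assumes "g \<in> carrier G" "h \<in> carrier G" "translation g = translation h" "height g = height h"
  shows "g = h"
proof -
  have "g \<otimes> inv h = \<one>"
    using assms n_neq_0
    by (intro eq_oneI) (simp_all add: translation_mult height_mult translation_inv height_inv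
        power_int_minus)
  then show ?thesis using assms by (simp add: inv_solve_right')
qed

text \<open>The inverse of the coordinate map: for \<open>x\<close> in Z[1/n] such an element
  exists, and by \<open>eqI\<close> it is unique.\<close>

definition elt :: "rat \<Rightarrow> int \<Rightarrow> bs_gen word set"
  where "elt x j = (SOME g. g \<in> carrier G \<and> translation g = x \<and> height g = j)"

lemma
  assumes "x \<in> Z_inverse n"
  shows elt_closed [simp]: "elt x j \<in> carrier G"
    and translation_elt [simp]: "translation (elt x j) = x"
    and height_elt [simp]: "height (elt x j) = j"
proof -
  obtain k l where x: "x = of_int k / of_int n ^ l"
    using Z_inverse_cases[OF assms n_neq_0] .
  \<comment> \<open>Conjugating \<open>a [^] k\<close> by \<open>t [^] l\<close> gives the
    translation by \<open>k / n ^ l\<close>; the further factor \<open>t [^] j\<close> sets the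
    height without changing the translation part.\<close>
  have "t [^] l \<otimes> a [^] k \<otimes> t [^] (j - int l) \<in> carrier G \<and>
    translation (t [^] l \<otimes> a [^] k \<otimes> t [^] (j - int l)) = x \<and>
    height (t [^] l \<otimes> a [^] k \<otimes> t [^] (j - int l)) = j"
    by (simp add: translation_normal_form height_normal_form x)
  from someI[where P = "\<lambda>g. g \<in> carrier G \<and> translation g = x \<and> height g = j", OF this]
  show "elt x j \<in> carrier G" "translation (elt x j) = x" "height (elt x j) = j"
    by (simp_all add: elt_def)
qed

text \<open>The affine maps in the image that fix 0 are y to y divided by a power of
  \<open>n\<close>, and \<open>t\<close> to the height realises each of them.\<close>

lemma generate_t: "generate G {t} = {g \<in> carrier G. translation g = 0}"
proof -
  have "g = t [^] height g" if "g \<in> carrier G" "translation g = 0" for g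
    using that by (intro eqI) (simp_all add: translation_t_pow height_t_pow)
  then show ?thesis
    unfolding generate_pow[OF t_closed] by (auto simp: translation_t_pow)
qed

section \<open>The lower central series\<close>

text \<open>Height 0 means slope 1, so these are the translations by elements of \<open>c\<close>
  times Z[1/n]. With \<open>c\<close> arbitrary, taking commutators with the group becomes the
  recursion from \<open>c\<close> to \<open>c * (n - 1)\<close>.\<close>

definition layer :: "int \<Rightarrow> bs_gen word set set"
  where "layer c = {g \<in> carrier G. height g = 0 \<and> (\<exists>y\<in>Z_inverse n. translation g = of_int c * y)}"

lemma layerI:
  "g \<in> carrier G \<Longrightarrow> height g = 0 \<Longrightarrow> y \<in> Z_inverse n \<Longrightarrow> translation g = of_int c * y
    \<Longrightarrow> g \<in> layer c"
  by (auto simp: layer_def)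

lemma layer_closed: "g \<in> layer c \<Longrightarrow> g \<in> carrier G"
  and height_layer: "g \<in> layer c \<Longrightarrow> height g = 0"
  by (auto simp: layer_def)

lemma layerE:
  assumes "g \<in> layer c"
  obtains y where "y \<in> Z_inverse n" "translation g = of_int c * y"
  using assms by (auto simp: layer_def)

lemma layer_mult:
  assumes "g \<in> layer c" "h \<in> layer c"
  shows "g \<otimes> h \<in> layer c" and "translation (g \<otimes> h) = translation g + translation h"
proof -
  show tr: "translation (g \<otimes> h) = translation g + translation h"
    using assms by (simp add: translation_mult layer_closed height_layer)
  obtain x y where "x \<in> Z_inverse n" "translation g = of_int c * x"
    "y \<in> Z_inverse n" "translation h = of_int c * y"
    using assms by (metis layerE)
  then show "g \<otimes> h \<in> layer c"
    using assms
    by (intro layerI[of _ "x + y"])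
      (simp_all add: tr layer_closed height_layer height_mult Z_inverse_add distrib_left)
qed

text \<open>Conjugation scales a translation by the slope of \<open>g\<close>. The slope is a power
  of \<open>n\<close>, a unit of Z[1/n], so multiples of \<open>c\<close> stay multiples of
  \<open>c\<close>.\<close>

lemma conj_layer:
  assumes "g \<in> carrier G" "h \<in> layer c"
  shows "g \<otimes> h \<otimes> inv g \<in> layer c"
    and "translation (g \<otimes> h \<otimes> inv g) = translation h * of_int n powi (- height g)"
proof -
  show tr: "translation (g \<otimes> h \<otimes> inv g) = translation h * of_int n powi (- height g)"
    using assms n_neq_0
    by (simp add: translation_mult translation_inv height_mult layer_closed height_layer power_int_minus)
  obtain y where "y \<in> Z_inverse n" "translation h = of_int c * y"
    using assms by (metis layerE)
  then show "g \<otimes> h \<otimes> inv g \<in> layer c"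
    using assms
    by (intro layerI[of _ "y * of_int n powi (- height g)"])
      (simp_all add: tr layer_closed height_layer height_mult height_inv Z_inverse_mult Z_inverse_powi
        del: power_int_minus)
qed

lemma subgroup_layer: "subgroup (layer c) G"
proof (rule subgroupI)
  show "layer c \<subseteq> carrier G" by (auto simp: layer_closed)
  have "\<one> \<in> layer c"
    using Z_inverse_of_int[of 0 n] by (intro layerI[of _ 0]) auto
  then show "layer c \<noteq> {}" by blast
next
  fix g assume g: "g \<in> layer c"
  obtain y where "y \<in> Z_inverse n" "translation g = of_int c * y"
    using g by (metis layerE)
  then show "inv g \<in> layer c"
    using g
    by (intro layerI[of _ "- y"])
      (simp_all add: translation_inv height_inv layer_closed height_layer Z_inverse_minus)
qed (rule layer_mult)

lemma normal_layer: "layer c \<lhd> G"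
  using subgroup_layer conj_layer(1) by (auto simp: normal_inv_iff)

section \<open>Commutators and the terms of the series\<close>

lemma translation_commutator:
  assumes "g \<in> carrier G" "h \<in> carrier G"
  shows "translation (inv g \<otimes> inv h \<otimes> g \<otimes> h) =
    translation g * of_int n powi height g * (of_int n powi height h - 1)
    - translation h * of_int n powi height h * (of_int n powi height g - 1)"
  using assms n_neq_0
  by (simp add: translation_mult translation_inv height_mult height_inv power_int_add algebra_simps)

lemma height_commutator:
  "g \<in> carrier G \<Longrightarrow> h \<in> carrier G \<Longrightarrow> height (inv g \<otimes> inv h \<otimes> g \<otimes> h) = 0"
  by (simp add: height_mult height_inv)

text \<open>Since \<open>t\<close> has height 1, the commutator of a translation by \<open>x\<close>
  with \<open>t\<close> is the translation by \<open>(n - 1) * x\<close>. Hence a single commutator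
  with \<open>t\<close> suffices, with \<open>x = c * y\<close>.\<close>

lemma layer_eq_commutator:
  assumes "g \<in> layer (c * (n - 1))"
  obtains h where "h \<in> layer c" "g = inv h \<otimes> inv t \<otimes> h \<otimes> t"
proof -
  obtain y where y: "y \<in> Z_inverse n" "translation g = of_int (c * (n - 1)) * y"
    using assms by (metis layerE)
  have cy: "of_int c * y \<in> Z_inverse n" by (rule Z_inverse_mult[OF Z_inverse_of_int y(1)])
  have t: "translation t = 0" "height t = 1"
    using translation_t_pow[of 1] height_t_pow[of 1] by simp_all
  have "g = inv (elt (of_int c * y) 0) \<otimes> inv t \<otimes> elt (of_int c * y) 0 \<otimes> t"
    using assms cy y
    by (intro eqI) (simp_all add: layer_closed height_layer translation_commutator
        height_commutator t)
  moreover have "elt (of_int c * y) 0 \<in> layer c"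
    using cy y by (intro layerI[of _ y]) simp_all
  ultimately show ?thesis using that by blast
qed

lemma commutator_subgroup_layer:
  "commutator_subgroup G (layer c) (carrier G) = layer (c * (n - 1))"
  unfolding commutator_subgroup_def
proof (intro equalityI generate_subgroup_incl subgroup_layer subsetI)
  fix x assume "x \<in> (\<Union>g\<in>layer c. \<Union>h\<in>carrier G. {inv g \<otimes> inv h \<otimes> g \<otimes> h})"
  then obtain g h where gh: "g \<in> layer c" "h \<in> carrier G" "x = inv g \<otimes> inv h \<otimes> g \<otimes> h"
    by blast
  obtain y where y: "y \<in> Z_inverse n" "translation g = of_int c * y"
    using gh by (metis layerE)
  obtain z where z: "z \<in> Z_inverse n" "of_int n powi height h - 1 = of_int (n - 1) * z"
    using powi_minus_1_dvd[OF n_neq_0] .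
  \<comment> \<open>As \<open>g\<close> has height 0, only the first summand of the commutator
    formula survives; \<open>c\<close> comes from \<open>g\<close> and \<open>n - 1\<close> from the
    slope of \<open>h\<close>.\<close>
  show "x \<in> layer (c * (n - 1))"
    using gh y z
    by (intro layerI[of _ "y * z"])
      (simp_all add: layer_closed height_layer height_commutator translation_commutator Z_inverse_mult)
next
  fix g assume "g \<in> layer (c * (n - 1))"
  then obtain h where "h \<in> layer c" "g = inv h \<otimes> inv t \<otimes> h \<otimes> t"
    by (rule layer_eq_commutator)
  then show "g \<in> generate G (\<Union>g\<in>layer c. \<Union>h\<in>carrier G. {inv g \<otimes> inv h \<otimes> g \<otimes> h})"
    using t_closed by (intro generate.incl) blast
qed

text \<open>The whole group contains elements of nonzero height and is not a layer, so the first
  commutator step is separate: here both summands of the formula contribute a factor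
  \<open>n - 1\<close>.\<close>

lemma commutator_subgroup_carrier:
  "commutator_subgroup G (carrier G) (carrier G) = layer (n - 1)"
  unfolding commutator_subgroup_def
proof (intro equalityI generate_subgroup_incl subgroup_layer subsetI)
  fix x assume "x \<in> (\<Union>g\<in>carrier G. \<Union>h\<in>carrier G. {inv g \<otimes> inv h \<otimes> g \<otimes> h})"
  then obtain g h where gh: "g \<in> carrier G" "h \<in> carrier G" "x = inv g \<otimes> inv h \<otimes> g \<otimes> h"
    by blast
  obtain y where y: "y \<in> Z_inverse n" "of_int n powi height g - 1 = of_int (n - 1) * y"
    using powi_minus_1_dvd[OF n_neq_0] .
  obtain z where z: "z \<in> Z_inverse n" "of_int n powi height h - 1 = of_int (n - 1) * z"
    using powi_minus_1_dvd[OF n_neq_0] .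
  \<comment> \<open>What remains of the commutator formula after \<open>n - 1\<close> is taken out
    of both summands.\<close>
  let ?w = "translation g * of_int n powi height g * z
    + - (translation h * of_int n powi height h * y)"
  show "x \<in> layer (n - 1)"
  proof (rule layerI)
    show "x \<in> carrier G" "height x = 0"
      using gh by (simp_all add: height_commutator)
    show "?w \<in> Z_inverse n"
      using gh y z
      by (intro Z_inverse_add Z_inverse_minus Z_inverse_mult Z_inverse_powi translation_in_Z_inverse)
    show "translation x = of_int (n - 1) * ?w"
      unfolding gh(3) translation_commutator[OF gh(1,2)] y(2) z(2)
      by (simp add: algebra_simps del: of_int_diff)
  qed
next
  \<comment> \<open>The case \<open>c = 1\<close>: already commutators of translations with
    \<open>t\<close> reach everything.\<close>
  fix g assume "g \<in> layer (n - 1)"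
  then obtain h where "h \<in> layer 1" "g = inv h \<otimes> inv t \<otimes> h \<otimes> t"
    using layer_eq_commutator[of g 1] by auto
  then show "g \<in> generate G (\<Union>g\<in>carrier G. \<Union>h\<in>carrier G. {inv g \<otimes> inv h \<otimes> g \<otimes> h})"
    using t_closed layer_closed by (intro generate.incl) blast
qed

lemma lower_central_eq_layer:
  assumes "i > 1"
  shows "lower_central G i = layer ((n - 1) ^ (i - 1))"
proof -
  have "lower_central G (Suc (Suc j)) = layer ((n - 1) ^ Suc j)" for j
    by (induction j) (simp_all add: commutator_subgroup_carrier commutator_subgroup_layer mult_ac)
  \<comment> \<open>The induction starts at the second term, which is \<open>layer (n - 1)\<close>;
    thus the exponent is one less than the index.\<close>
  from this[of "i - 2"] show ?thesis
    using assms by (simp add: numeral_2_eq_2 Suc_diff_Suc)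
qed

section \<open>Elements, isomorphism types and quotients of the layers\<close>

lemma layer_eq_conjugates:
  "layer c = {t [^] l \<otimes> a [^] (\<alpha> * c) \<otimes> inv (t [^] l) | (l::nat) (\<alpha>::int). True}"
proof -
  have nf: "t [^] l \<otimes> a [^] (\<alpha> * c) \<otimes> inv (t [^] l) = t [^] l \<otimes> a [^] (\<alpha> * c) \<otimes> t [^] (- int l)"
    for l :: nat and \<alpha>
    by (simp add: int_pow_neg_int)
  show ?thesis
  proof (intro equalityI subsetI)
    fix g assume g: "g \<in> layer c"
    then obtain y where y: "y \<in> Z_inverse n" "translation g = of_int c * y"
      by (rule layerE)
    \<comment> \<open>The numerator and the denominator exponent of \<open>y\<close> are the
      required parameters: the conjugate has height 0 and translation
      \<open>\<alpha> * c / n ^ l\<close>.\<close>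
    obtain \<alpha> l where "y = of_int \<alpha> / of_int n ^ l"
      using Z_inverse_cases[OF y(1) n_neq_0] .
    then have "g = t [^] l \<otimes> a [^] (\<alpha> * c) \<otimes> inv (t [^] l)"
      unfolding nf using g y
      by (intro eqI) (simp_all add: layer_closed height_layer translation_normal_form
          height_normal_form mult.commute)
    then show "g \<in> {t [^] l \<otimes> a [^] (\<alpha> * c) \<otimes> inv (t [^] l) | (l::nat) (\<alpha>::int). True}"
      by blast
  next
    fix g assume "g \<in> {t [^] l \<otimes> a [^] (\<alpha> * c) \<otimes> inv (t [^] l) | (l::nat) (\<alpha>::int). True}"
    then obtain l :: nat and \<alpha> :: int where "g = t [^] l \<otimes> a [^] (\<alpha> * c) \<otimes> t [^] (- int l)"
      unfolding nf by blast
    then show "g \<in> layer c"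
      using Z_inverse_frac[of \<alpha> n l]
      by (intro layerI[of _ "of_int \<alpha> / of_int n ^ l"])
        (simp_all add: translation_normal_form height_normal_form mult.commute)
  qed
qed

text \<open>Nonzero multiples of Z[1/n] are all isomorphic by rescaling, so \<open>c\<close> and
  \<open>d\<close> are independent. The theorem uses exponents \<open>i - 1\<close> for
  \<open>c\<close> and \<open>i - 2\<close> for \<open>d\<close>.\<close>

lemma layer_iso_rat_additive:
  assumes "c \<noteq> 0" "d \<noteq> 0"
  shows "G\<lparr>carrier := layer c\<rparr> \<cong> rat_additive ((\<lambda>x. of_int d * x) ` Z_inverse n)"
proof (rule is_isoI)
  let ?f = "\<lambda>g. of_int d * (translation g / of_int c)"
  have "?f \<in> hom (G\<lparr>carrier := layer c\<rparr>) (rat_additive ((\<lambda>x. of_int d * x) ` Z_inverse n))"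
    using assms
    by (auto simp: hom_def rat_additive_def layer_mult add_divide_distrib distrib_left elim!: layerE)
  moreover have "inj_on ?f (layer c)"
    using assms by (intro inj_onI eqI) (simp_all add: layer_closed height_layer)
  moreover have "?f ` layer c = (\<lambda>x. of_int d * x) ` Z_inverse n"
  proof (intro equalityI subsetI)
    fix z assume "z \<in> ?f ` layer c"
    then show "z \<in> (\<lambda>x. of_int d * x) ` Z_inverse n"
      using assms by (auto elim!: layerE)
  next
    fix z assume "z \<in> (\<lambda>x. of_int d * x) ` Z_inverse n"
    then obtain x where x: "x \<in> Z_inverse n" "z = of_int d * x" by blast
    then have cx: "of_int c * x \<in> Z_inverse n" by (intro Z_inverse_mult Z_inverse_of_int)
    then have "elt (of_int c * x) 0 \<in> layer c"
      using x by (intro layerI[of _ x]) simp_all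
    moreover have "z = ?f (elt (of_int c * x) 0)"
      using x cx assms by simp
    ultimately show "z \<in> ?f ` layer c" by blast
  qed
  ultimately show "?f \<in> iso (G\<lparr>carrier := layer c\<rparr>) (rat_additive ((\<lambda>x. of_int d * x) ` Z_inverse n))"
    by (simp add: iso_def bij_betw_def rat_additive_def)
qed

text \<open>First isomorphism theorem for the residue of the translation part divided by
  \<open>c\<close>; by \<open>residue_eq_0_iff\<close> its kernel is the next layer.\<close>

lemma layer_Mod_iso:
  assumes "c \<noteq> 0"
  shows "G\<lparr>carrier := layer c\<rparr> Mod layer (c * (n - 1)) \<cong> integer_mod_group (nat \<bar>n - 1\<bar>)"
proof -
  let ?L = "G\<lparr>carrier := layer c\<rparr>" and ?Z = "integer_mod_group (nat \<bar>n - 1\<bar>)"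
  let ?h = "\<lambda>g. residue n (translation g / of_int c)"
  \<comment> \<open>The modulus is positive because \<open>n \<noteq> 1\<close>; for modulus 0 the
    carrier would be all integers.\<close>
  have carrier_Z: "carrier ?Z = {0..<\<bar>n - 1\<bar>}"
    using n_neq_1 by (simp add: carrier_integer_mod_group)
  have quot: "translation g / of_int c \<in> Z_inverse n" if "g \<in> layer c" for g
    using that assms by (auto elim: layerE)
  interpret L: group ?L by (rule subgroup_imp_group[OF subgroup_layer])
  interpret Z: group ?Z by simp
  have "?h \<in> hom ?L ?Z"
    using n_neq_1
    by (auto simp: hom_def carrier_Z layer_mult add_divide_distrib residue_add n_neq_0 quot)
      (simp_all add: residue_def)
  then interpret group_hom ?L ?Z ?h by unfold_locales
  have surj: "?h ` carrier ?L = carrier ?Z"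
  proof (intro equalityI subsetI)
    fix k assume "k \<in> carrier ?Z"
    then have k: "k mod \<bar>n - 1\<bar> = k" by (simp add: carrier_Z)
    \<comment> \<open>The translation by \<open>c * k\<close> is a preimage of
      \<open>k\<close>.\<close>
    have ck: "of_int c * of_int k \<in> Z_inverse n" by (intro Z_inverse_mult Z_inverse_of_int)
    then have "elt (of_int c * of_int k) 0 \<in> layer c"
      using Z_inverse_of_int by (intro layerI[of _ "of_int k"]) simp_all
    moreover have "k = ?h (elt (of_int c * of_int k) 0)"
      using ck assms residue_frac[OF n_neq_0, of k 0] k by simp
    ultimately show "k \<in> ?h ` carrier ?L" by simp
  qed auto
  have "kernel ?L ?Z ?h = layer (c * (n - 1))"
  proof -
    have "g \<in> layer c \<and> ?h g = 0 \<longleftrightarrow> g \<in> layer (c * (n - 1))" for g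
    proof
      assume "g \<in> layer c \<and> ?h g = 0"
      then have g: "g \<in> layer c" and "\<exists>y\<in>Z_inverse n. translation g / of_int c = of_int (n - 1) * y"
        using residue_eq_0_iff[OF n_neq_0 quot] by auto
      then obtain y where "y \<in> Z_inverse n" "translation g = of_int (c * (n - 1)) * y"
        using assms by (auto simp: nonzero_divide_eq_eq mult_ac)
      with g show "g \<in> layer (c * (n - 1))"
        by (intro layerI[of _ y]) (simp_all add: layer_closed height_layer)
    next
      assume g: "g \<in> layer (c * (n - 1))"
      obtain y where y: "y \<in> Z_inverse n" "translation g = of_int (c * (n - 1)) * y"
        using g by (rule layerE)
      have "of_int (n - 1) * y \<in> Z_inverse n" by (rule Z_inverse_mult[OF Z_inverse_of_int y(1)])
      with g y have "g \<in> layer c"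
        by (intro layerI[of _ "of_int (n - 1) * y"]) (simp_all add: layer_closed height_layer)
      moreover have "translation g / of_int c = of_int (n - 1) * y"
        using y assms by simp
      ultimately show "g \<in> layer c \<and> ?h g = 0"
        using residue_eq_0_iff[OF n_neq_0 quot] y(1) by blast
    qed
    then show ?thesis by (auto simp: kernel_def)
  qed
  with FactGroup_iso[OF surj] show ?thesis by simp
qed

text \<open>The commutator subgroup consists of translations, and these commute.\<close>

lemma metabelian: "metabelian G"
  unfolding metabelian_def commutator_subgroup_carrier
proof (intro conjI is_group group.group_comm_groupI subgroup_imp_group subgroup_layer)
  fix g h
  assume "g \<in> carrier (G\<lparr>carrier := layer (n - 1)\<rparr>)" "h \<in> carrier (G\<lparr>carrier := layer (n - 1)\<rparr>)"
  then have gh: "g \<in> layer (n - 1)" "h \<in> layer (n - 1)" by simp_all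
  have "g \<otimes> h = h \<otimes> g"
    using gh layer_mult(1)[OF gh] layer_mult(1)[OF gh(2,1)]
    by (intro eqI) (simp_all add: layer_closed height_layer layer_mult height_mult)
  then show "g \<otimes>\<^bsub>G\<lparr>carrier := layer (n - 1)\<rparr>\<^esub> h = h \<otimes>\<^bsub>G\<lparr>carrier := layer (n - 1)\<rparr>\<^esub> g"
    by simp
qed

section \<open>The infinite cyclic complement and the semidirect product\<close>

lemma layer_Int_generate_t: "layer c \<inter> generate G {t} = {\<one>}"
proof -
  have "g = \<one>" if "g \<in> layer c" "g \<in> generate G {t}" for g
    using that by (intro eq_oneI) (simp_all add: generate_t height_layer)
  moreover have "\<one> \<in> layer c" by (rule subgroup.one_closed[OF subgroup_layer])
  moreover have "\<one> \<in> generate G {t}" by (rule generate.one)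
  ultimately show ?thesis by blast
qed

text \<open>The isomorphism is \<open>height\<close>: it is additive and recovers the exponent of a
  power of \<open>t\<close>.\<close>

lemma generate_t_iso: "G\<lparr>carrier := generate G {t}\<rparr> \<cong> integer_group"
proof (rule is_isoI)
  have "inj_on height (generate G {t})"
    by (intro inj_onI eqI) (simp_all add: generate_t)
  moreover have "k \<in> height ` generate G {t}" for k
    using Z_inverse_of_int[of 0 n] by (intro image_eqI[of _ _ "elt 0 k"]) (simp_all add: generate_t)
  ultimately show "height \<in> iso (G\<lparr>carrier := generate G {t}\<rparr>) integer_group"
    by (auto simp: iso_def hom_def bij_betw_def integer_group_def height_mult generate_t)
qed

text \<open>
  The product map \<open>(x, s) \<mapsto> x s\<close> only reaches the elements with translation part in
  \<open>(n - 1) \<int>[1/n]\<close>, a proper subset unless \<open>n = 2\<close>. The isomorphism therefore divides the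
  translation part of \<open>x\<close> by \<open>n - 1\<close>, which commutes with conjugation by \<open>t\<close>.
\<close>

lemma conj_semidirect_iso:
  "\<exists>f \<in> iso (conj_semidirect G (layer (n - 1)) (generate G {t})) G.
    \<forall>s \<in> generate G {t}. f (\<one>, s) = s"
proof
  let ?f = "\<lambda>(x, s). elt (translation x / of_int (n - 1)) (height s)"
  let ?S = "layer (n - 1) \<times> generate G {t}"
  have quot: "translation x / of_int (n - 1) \<in> Z_inverse n" if "x \<in> layer (n - 1)" for x
    using that n_neq_1 by (auto elim!: layerE)
  have zero: "0 \<in> Z_inverse n" using Z_inverse_of_int[of 0 n] by simp
  have "?f \<in> hom (conj_semidirect G (layer (n - 1)) (generate G {t})) G"
  proof (rule homI)
    fix p q
    assume "p \<in> carrier (conj_semidirect G (layer (n - 1)) (generate G {t}))"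
      "q \<in> carrier (conj_semidirect G (layer (n - 1)) (generate G {t}))"
    then obtain x s y r where p: "p = (x, s)" "x \<in> layer (n - 1)" "s \<in> generate G {t}"
      and q: "q = (y, r)" "y \<in> layer (n - 1)" "r \<in> generate G {t}"
      by (auto simp: conj_semidirect_def semidirect_product_def)
    note s = p(3)[unfolded generate_t, simplified] and r = q(3)[unfolded generate_t, simplified]
    have sy: "s \<otimes> y \<otimes> inv s \<in> layer (n - 1)"
      using s q by (intro conj_layer) simp_all
    have xsy: "x \<otimes> (s \<otimes> y \<otimes> inv s) \<in> layer (n - 1)"
      by (rule layer_mult(1)[OF p(2) sy])
    \<comment> \<open>The action of \<open>s\<close> scales by the same slope that occurs in
      \<open>translation_mult\<close>, so the semidirect multiplication matches composition even
      after division by \<open>n - 1\<close>.\<close>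
    have tr: "translation (x \<otimes> (s \<otimes> y \<otimes> inv s))
        = translation x + translation y * of_int n powi (- height s)"
      using layer_mult(2)[OF p(2) sy] conj_layer(2)[of s y "n - 1"] s q by simp
    have "elt (translation (x \<otimes> (s \<otimes> y \<otimes> inv s)) / of_int (n - 1)) (height (s \<otimes> r)) = ?f p \<otimes> ?f q"
    proof (rule eqI)
      show "translation (elt (translation (x \<otimes> (s \<otimes> y \<otimes> inv s)) / of_int (n - 1)) (height (s \<otimes> r)))
          = translation (?f p \<otimes> ?f q)"
        unfolding translation_elt[OF quot[OF xsy]] unfolding tr
        using p q quot by (simp add: translation_mult add_divide_distrib del: of_int_diff)
      show "height (elt (translation (x \<otimes> (s \<otimes> y \<otimes> inv s)) / of_int (n - 1)) (height (s \<otimes> r)))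
          = height (?f p \<otimes> ?f q)"
        unfolding height_elt[OF quot[OF xsy]]
        using p q s r quot by (simp add: height_mult del: of_int_diff)
    qed (use p q quot[OF xsy] quot in \<open>simp_all del: of_int_diff\<close>)
    then show "?f (p \<otimes>\<^bsub>conj_semidirect G (layer (n - 1)) (generate G {t})\<^esub> q) = ?f p \<otimes> ?f q"
      by (simp add: p q conj_semidirect_def semidirect_product_def)
  qed (auto simp: conj_semidirect_def semidirect_product_def quot simp del: of_int_diff)
  moreover have "inj_on ?f ?S"
  proof (rule inj_onI)
    fix p q assume "p \<in> ?S" "q \<in> ?S" and eq: "?f p = ?f q"
    then obtain x s y r where p: "p = (x, s)" "x \<in> layer (n - 1)" "s \<in> generate G {t}"
      and q: "q = (y, r)" "y \<in> layer (n - 1)" "r \<in> generate G {t}"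
      by blast
    have "translation x / of_int (n - 1) = translation y / of_int (n - 1)" "height s = height r"
      using arg_cong[OF eq, of translation] arg_cong[OF eq, of height]
      unfolding p(1) q(1) prod.case
        translation_elt[OF quot[OF p(2)]] translation_elt[OF quot[OF q(2)]]
        height_elt[OF quot[OF p(2)]] height_elt[OF quot[OF q(2)]] .
    then have "translation x = translation y" "height s = height r"
      using n_neq_1 by simp_all
    then show "p = q"
      unfolding p(1) q(1) using p q
      by (intro arg_cong2[of _ _ _ _ Pair] eqI) (simp_all add: generate_t layer_closed height_layer)
  qed
  moreover have "g \<in> ?f ` ?S" if g: "g \<in> carrier G" for g
  proof -
    \<comment> \<open>The preimage of \<open>g\<close> pairs the translation part, multiplied back
      by \<open>n - 1\<close>, with the power of \<open>t\<close> of the same height.\<close>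
    let ?x = "of_int (n - 1) * translation g"
    have tr: "translation g \<in> Z_inverse n" by (rule translation_in_Z_inverse[OF g])
    then have x: "?x \<in> Z_inverse n" by (intro Z_inverse_mult Z_inverse_of_int)
    have "elt ?x 0 \<in> layer (n - 1)"
      using x tr by (intro layerI[of _ "translation g"]) (simp_all del: of_int_diff)
    moreover have "elt 0 (height g) \<in> generate G {t}"
      using zero by (simp add: generate_t)
    moreover have "g = ?f (elt ?x 0, elt 0 (height g))"
      using g tr x zero n_neq_1 by (intro eqI) simp_all
    ultimately show ?thesis by (intro image_eqI[of _ _ "(elt ?x 0, elt 0 (height g))"]) simp_all
  qed
  ultimately show "?f \<in> iso (conj_semidirect G (layer (n - 1)) (generate G {t})) G"
    by (auto simp: iso_def bij_betw_def conj_semidirect_def semidirect_product_def quot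
        simp del: of_int_diff)
  show "\<forall>s \<in> generate G {t}. ?f (\<one>, s) = s"
    using zero by (intro ballI eqI) (simp_all add: generate_t)
qed

end

text \<open>The decomposition in part 3 is expressed by an isomorphism from the semidirect product
  that fixes the powers of \<open>t\<close>, because the products of elements of \<open>G'\<close>
  with powers of \<open>t\<close> need not exhaust the group.\<close>

theorem theorem1:
  fixes n :: int and G (structure)
  assumes "n \<noteq> 0" and "n \<noteq> 1"
    and "G = BS1 n" and "a = BS1_a n" and "t = BS1_t n"
    and "G' = commutator_subgroup G (carrier G) (carrier G)"
  shows
    "(\<forall>i>1. lower_central G i =
        {t [^] l \<otimes> a [^] (\<alpha> * (n - 1) ^ (i - 1)) \<otimes> inv (t [^] l) | (l::nat) (\<alpha>::int). True})
     \<and> (\<forall>i>1. G\<lparr>carrier := lower_central G i\<rparr>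
          \<cong> rat_additive ((\<lambda>x. of_int ((n - 1) ^ (i - 2)) * x) ` Z_inverse n))
     \<and> metabelian G
     \<and> (G' \<lhd> G \<and> G' \<inter> generate G {t} = {\<one>}
        \<and> G\<lparr>carrier := generate G {t}\<rparr> \<cong> integer_group
        \<and> (\<exists>f \<in> iso (conj_semidirect G G' (generate G {t})) G.
              \<forall>s \<in> generate G {t}. f (\<one>, s) = s))
     \<and> (\<forall>i>1. (G\<lparr>carrier := lower_central G i\<rparr>) Mod (lower_central G (i + 1))
          \<cong> integer_mod_group (nat \<bar>n - 1\<bar>))"
proof -
  interpret baumslag_solitar_1 n G a t
    by unfold_locales (use assms in auto)
  have G': "G' = layer (n - 1)"
    by (simp only: assms(6) commutator_subgroup_carrier)
  have pow: "(n - 1) ^ j \<noteq> 0" for j using n_neq_1 by simp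
  have quotient: "G\<lparr>carrier := lower_central G i\<rparr> Mod lower_central G (i + 1)
      \<cong> integer_mod_group (nat \<bar>n - 1\<bar>)" if "i > 1" for i
  proof -
    \<comment> \<open>This puts the next term of the series in the form
      \<open>layer (c * (n - 1))\<close> required by \<open>layer_Mod_iso\<close>.\<close>
    have "(n - 1) ^ (i + 1 - 1) = (n - 1) ^ (i - 1) * (n - 1)"
      using that by (cases i) (simp_all add: mult.commute)
    then have "lower_central G (i + 1) = layer ((n - 1) ^ (i - 1) * (n - 1))"
      using that lower_central_eq_layer[of "i + 1"] by simp
    then show ?thesis
      using that layer_Mod_iso[OF pow, of "i - 1"] by (simp only: lower_central_eq_layer)
  qed
  show ?thesis
    unfolding G'
    using lower_central_eq_layer layer_eq_conjugates layer_iso_rat_additive[OF pow pow] metabelian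
      normal_layer layer_Int_generate_t generate_t_iso conj_semidirect_iso quotient
    by (intro conjI allI impI) simp_all
qed

end
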